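(* For an even $C^2$ strictly convex function $P$ on $\mathbb{R}$ set $\mathcal{N}_P(y):=P'(y)-yP''(y)$ for $y>0$. Fix an integer $k\ge1$ and put $\omega_k(y):=\dfrac{y^{2k+1}}{1+y^{2k+1}}$ for $y>0$. Suppose that an even $C^2$ strictly convex function $P_0:\mathbb{R}\to\mathbb{R}$ satisfies $P_0'(0)=0$ and, for some $m>0$, $$\mathcal{N}_{P_0}(y)\ge m\,\omega_k(y)\qquad(y>0).$$ If $P:\mathbb{R}\to\mathbb{R}$ is another even $C^2$ strictly convex function with $P'(0)=0$ and $$\sup_{y>0}\frac{|\mathcal{N}_P(y)-\mathcal{N}_{P_0}(y)|}{\omega_k(y)}<m,$$ then $y\mapsto y/P'(y)$ is strictly increasing on $(0,\infty)$. *)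

theory Defs
  imports "HOL-Analysis.Analysis"
begin

definition strictly_convex_on :: "'a::real_vector set \<Rightarrow> ('a \<Rightarrow> real) \<Rightarrow> bool" where
  "strictly_convex_on S f \<longleftrightarrow> convex S \<and>
     (\<forall>x\<in>S. \<forall>y\<in>S. \<forall>t. x \<noteq> y \<longrightarrow> 0 < t \<longrightarrow> t < 1 \<longrightarrow>
        f ((1 - t) *\<^sub>R x + t *\<^sub>R y) < (1 - t) * f x + t * f y)"

definition even_function :: "(real \<Rightarrow> real) \<Rightarrow> bool" where
  "even_function f \<longleftrightarrow> (\<forall>x. f (- x) = f x)"

(* The differentiability conjuncts are needed because deriv is total and unspecified
   where no derivative exists. *)
definition C2 :: "(real \<Rightarrow> real) \<Rightarrow> bool" where
  "C2 f \<longleftrightarrow> f differentiable_on UNIV \<and> deriv f differentiable_on UNIV \<and>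
     continuous_on UNIV (deriv (deriv f))"

definition N_op :: "(real \<Rightarrow> real) \<Rightarrow> real \<Rightarrow> real" where
  "N_op P y = deriv P y - y * deriv (deriv P) y"

definition omega :: "nat \<Rightarrow> real \<Rightarrow> real" where
  "omega k y = y ^ (2 * k + 1) / (1 + y ^ (2 * k + 1))"

(* The supremum is taken in the extended reals: it is infinite when the quotient is unbounded,
   whereas the real-valued Sup of an unbounded set is an unspecified real. *)
definition N_dist :: "nat \<Rightarrow> (real \<Rightarrow> real) \<Rightarrow> (real \<Rightarrow> real) \<Rightarrow> ereal" where
  "N_dist k P Q = (SUP y\<in>{0<..}. ereal (\<bar>N_op P y - N_op Q y\<bar> / omega k y))"

end

theory Submission
  imports Defs
begin

text \<open>
  On \<open>(0, \<infinity>)\<close> the derivative of \<open>y / P' y\<close> is \<open>N_op P y / (P' y)\<^sup>2\<close>, so it is enough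
  that \<open>P'\<close> does not vanish there and that \<open>N_op P\<close> is positive. Positivity of \<open>P'\<close>
  follows from the tangent inequality at \<open>y\<close>, because an even strictly convex function
  takes its strict minimum at \<open>0\<close>. Positivity of \<open>N_op P\<close> holds because \<open>N_op P\<close> differs
  from \<open>N_op P\<^sub>0\<close> by strictly less than \<open>m * omega k y\<close>, which is a lower bound for
  \<open>N_op P\<^sub>0\<close>.
\<close>

lemma strictly_convex_on_imp_convex_on:
  assumes "strictly_convex_on S f"
  shows "convex_on S f"
proof (rule convex_onI)
  fix t :: real and x y assume t: "0 < t" "t < 1" and xy: "x \<in> S" "y \<in> S"
  show "f ((1 - t) *\<^sub>R x + t *\<^sub>R y) \<le> (1 - t) * f x + t * f y"
  proof (cases "x = y")
    case True
    then show ?thesis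
      by (simp flip: scaleR_left_distrib distrib_right)
  next
    case False
    then show ?thesis
      using assms t xy unfolding strictly_convex_on_def by (simp add: less_imp_le)
  qed
qed (use assms in \<open>simp add: strictly_convex_on_def\<close>)

lemma even_strictly_convex_min_at_zero:
  assumes "even_function f" "strictly_convex_on UNIV f" "y \<noteq> 0"
  shows "f 0 < f y"
proof -
  \<comment> \<open>strict convexity at \<open>0\<close>, the midpoint of \<open>- y\<close> and \<open>y\<close>\<close>
  have "f ((1 - 1/2) *\<^sub>R (- y) + (1/2) *\<^sub>R y) < (1 - 1/2) * f (- y) + 1/2 * f y"
    using assms(2)[unfolded strictly_convex_on_def, THEN conjunct2, rule_format, of "- y" y "1/2"] assms(3)
    by simp
  then show ?thesis
    using assms(1) by (simp add: even_function_def)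
qed

lemma C2_DERIV:
  assumes "C2 f"
  shows "(f has_real_derivative deriv f x) (at x)"
    and "(deriv f has_real_derivative deriv (deriv f) x) (at x)"
  using assms unfolding C2_def differentiable_on_def
  by (auto simp: DERIV_deriv_iff_real_differentiable)

lemma even_strictly_convex_deriv_pos:
  assumes "even_function f" "C2 f" "strictly_convex_on UNIV f" "0 < y"
  shows "0 < deriv f y"
proof -
  have "f 0 - f y \<ge> deriv f y * (0 - y)"
    by (rule convex_on_imp_above_tangent[OF strictly_convex_on_imp_convex_on[OF assms(3)]])
       (use C2_DERIV(1)[OF assms(2)] in auto)
  moreover have "f 0 < f y"
    using even_strictly_convex_min_at_zero assms by auto
  ultimately have "0 < deriv f y * y"
    by simp
  then show ?thesis
    using \<open>0 < y\<close> by (simp add: zero_less_mult_iff)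
qed

lemma omega_pos: "0 < y \<Longrightarrow> 0 < omega k y"
  by (simp add: omega_def add_pos_pos)

lemma N_dist_less_imp:
  assumes "N_dist k P Q < ereal m" "0 < y"
  shows "\<bar>N_op P y - N_op Q y\<bar> < m * omega k y"
proof -
  have "ereal (\<bar>N_op P y - N_op Q y\<bar> / omega k y) \<le> N_dist k P Q"
    unfolding N_dist_def using \<open>0 < y\<close> by (intro SUP_upper) simp
  then have "\<bar>N_op P y - N_op Q y\<bar> / omega k y < m"
    using assms(1) order_le_less_trans by fastforce
  then show ?thesis
    using omega_pos[OF \<open>0 < y\<close>] by (simp add: pos_divide_less_eq)
qed

lemma N_op_pos_imp_strict_mono_quotient:
  assumes "even_function f" "C2 f" "strictly_convex_on UNIV f"
    and N_pos: "\<And>y. 0 < y \<Longrightarrow> 0 < N_op f y"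
  shows "strict_mono_on {0<..} (\<lambda>y. y / deriv f y)"
proof (rule strict_mono_onI)
  fix a b :: real assume ab: "a \<in> {0<..}" "b \<in> {0<..}" "a < b"
  show "a / deriv f a < b / deriv f b"
  proof (rule DERIV_pos_imp_increasing[OF \<open>a < b\<close>])
    fix y assume "a \<le> y" "y \<le> b"
    then have y: "0 < y"
      using ab by simp
    then have d: "0 < deriv f y"
      by (rule even_strictly_convex_deriv_pos[OF assms(1-3)])
    have "((\<lambda>y. y / deriv f y) has_real_derivative N_op f y / (deriv f y)\<^sup>2) (at y)"
      using d by (auto intro!: derivative_eq_intros C2_DERIV(2)[OF assms(2)]
          simp: N_op_def power2_eq_square)
    moreover have "0 < N_op f y / (deriv f y)\<^sup>2"
      using N_pos[OF y] d by simp
    ultimately show "\<exists>D. ((\<lambda>y. y / deriv f y) has_real_derivative D) (at y) \<and> 0 < D"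
      by blast
  qed
qed

theorem proposition6p10:
  fixes k :: nat and m :: real and P\<^sub>0 P :: "real \<Rightarrow> real"
  assumes "1 \<le> k" and "0 < m"
    and "even_function P\<^sub>0" and "C2 P\<^sub>0" and "strictly_convex_on UNIV P\<^sub>0"
    and "deriv P\<^sub>0 0 = 0"
    and "\<forall>y>0. N_op P\<^sub>0 y \<ge> m * omega k y"
    and "even_function P" and "C2 P" and "strictly_convex_on UNIV P"
    and "deriv P 0 = 0"
    and "N_dist k P P\<^sub>0 < ereal m"
  shows "strict_mono_on {0<..} (\<lambda>y. y / deriv P y)"
proof (rule N_op_pos_imp_strict_mono_quotient)
  fix y :: real assume y: "0 < y"
  have "\<bar>N_op P y - N_op P\<^sub>0 y\<bar> < m * omega k y"
    by (rule N_dist_less_imp) fact+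
  moreover have "m * omega k y \<le> N_op P\<^sub>0 y"
    using assms(7) y by blast
  ultimately show "0 < N_op P y"
    by linarith
qed fact+

end
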